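(* Let $N$ be a nonnegative integer and let $\sigma>0$. Then the inequality $$\sum_{k=0}^N\frac{(-1)^k}{\sigma^{2k}}\binom{N}{k}\int_{-\infty}^{\infty}\big|f^{(k)}(x)\big|^2\,dx\ge 0$$ holds for every entire function $f$ of exponential type at most $\sigma$ such that $f\in L^2(\mathbb{R})$. In particular, for $N=2$, $$\int_{-\infty}^{\infty}|f'(x)|^2\,dx\le\frac12\left(\sigma^2\int_{-\infty}^{\infty}|f(x)|^2\,dx+\frac{1}{\sigma^2}\int_{-\infty}^{\infty}|f''(x)|^2\,dx\right).$$
   Context: An entire function $f:\mathbb{C}\to\mathbb{C}$ has exponential type at most $\sigma$ if for every $\varepsilon>0$ there is $C_\varepsilon>0$ with $|f(z)|\le C_\varepsilon e^{(\sigma+\varepsilon)|z|}$ for all $z\in\mathbb{C}$. $f\in L^2(\mathbb{R})$ means that the restriction of $f$ to $\mathbb{R}$ is square-integrable; $f^{(k)}$ denotes the $k$-th derivative. *)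

theory Defs
  imports "HOL-Complex_Analysis.Complex_Analysis"
begin

definition exp_type_at_most :: "real \<Rightarrow> (complex \<Rightarrow> complex) \<Rightarrow> bool" where
  "exp_type_at_most \<sigma> f \<longleftrightarrow>
     (\<forall>\<epsilon>>0. \<exists>C>0. \<forall>z. norm (f z) \<le> C * exp ((\<sigma> + \<epsilon>) * norm z))"

definition square_integrable_real_line :: "(complex \<Rightarrow> complex) \<Rightarrow> bool" where
  "square_integrable_real_line f \<longleftrightarrow>
     (\<lambda>x::real. f (complex_of_real x)) \<in> borel_measurable lborel \<and>
     integrable lborel (\<lambda>x::real. (norm (f (complex_of_real x)))\<^sup>2)"

text \<open>
  The integral is 0 for functions that are not integrable, so statements about this
  quantity are only meaningful together with \<^const>\<open>square_integrable_real_line\<close>.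
\<close>

definition sq_integral :: "(complex \<Rightarrow> complex) \<Rightarrow> real" where
  "sq_integral f = (LINT x::real|lborel. (norm (f (complex_of_real x)))\<^sup>2)"

end

theory Submission
  imports Defs
begin

text \<open>
  On the space of entire \<open>L\<^sup>2\<close> functions of exponential type at most \<open>\<sigma>\<close> the derivative \<open>D\<close>
  is skew-adjoint, and by Bernstein's inequality its norm is at most \<open>\<sigma>\<close>. Hence \<open>1 + D\<^sup>2 / \<sigma>\<^sup>2\<close>
  is a positive operator, and so are its powers, whose quadratic forms are the sums in question.

  Bernstein's inequality is obtained without the Fourier transform. By the Phragmen-Lindelof
  principle, the correlation of \<open>f\<close> with a compactly supported function \<open>h\<close> grows at most like
  \<open>exp (\<sigma> \<bar>Im z\<bar>)\<close>, with a constant controlled by the \<open>L\<^sup>2\<close> norms of \<open>f\<close> and \<open>h\<close>. Cauchy's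
  inequality and duality then bound the norm of the \<open>k\<close>-th derivative by that of \<open>f\<close> times
  \<open>\<sigma>\<^sup>k\<close>, up to a factor linear in \<open>k\<close>, and log-convexity of these norms removes the factor.
\<close>

section \<open>The Phragmen-Lindelof principle\<close>

text \<open>The maximum modulus principle applies to the compact set
  \<open>S \<inter> cball 0 R\<close>, whose frontier lies in \<open>frontier S\<close> or on the
  circle of radius \<open>R\<close>. The assumption \<open>far\<close> covers the circle and so
  stands in for compactness of \<open>S\<close>.\<close>

lemma norm_le_on_closed_set:
  assumes "u holomorphic_on U" "open U" "closed S" "S \<subseteq> U"
    and frontier: "\<And>z. z \<in> frontier S \<Longrightarrow> norm (u z) \<le> B"
    and far: "\<And>z. z \<in> S \<Longrightarrow> norm z \<ge> R \<Longrightarrow> norm (u z) \<le> B"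
    and "\<xi> \<in> S"
  shows "norm (u \<xi>) \<le> (B::real)"
proof (cases "norm \<xi> \<ge> R")
  case False
  let ?T = "S \<inter> cball 0 R"
  have "closed ?T" using \<open>closed S\<close> by auto
  have hol: "u holomorphic_on ?T"
    using assms(1,4) by (rule holomorphic_on_subset[OF _ order_trans[rotated]]) auto
  show ?thesis
  proof (rule maximum_modulus_frontier[of u ?T])
    show "u holomorphic_on interior ?T"
      using hol interior_subset by (rule holomorphic_on_subset)
    show "continuous_on (closure ?T) u"
      using hol \<open>closed ?T\<close> by (simp add: holomorphic_on_imp_continuous_on)
    show "norm (u z) \<le> B" if "z \<in> frontier ?T" for z
    proof -
      have "z \<in> ?T" using that \<open>closed ?T\<close> frontier_subset_closed by blast
      moreover have "z \<in> frontier S \<or> z \<in> frontier (cball 0 R)"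
        using that frontier_Int_subset by blast
      ultimately show ?thesis using frontier far by auto
    qed
  qed (use False assms in auto)
qed (use assms in auto)

text \<open>If \<open>v\<^sup>2\<close> lies within angle pi/4 of the positive axis, then
  \<open>v\<close> lies within pi/8, so \<open>v ^ 3\<close> stays strictly inside the right
  half-plane. In coordinates the cruder \<open>2 * \<bar>b\<bar> \<le> a\<close> is enough.\<close>

lemma Re_cubed_ge:
  assumes "Re v \<ge> 0" "\<bar>Im (v\<^sup>2)\<bar> \<le> Re (v\<^sup>2)"
  shows "Re (v ^ 3) \<ge> Re v ^ 3 / 4" "norm (v\<^sup>2) \<le> 2 * (Re v)\<^sup>2"
proof -
  define a b where "a = Re v" and "b = Im v"
  have a: "a \<ge> 0" using assms by (simp add: a_def)
  have le: "2 * a * \<bar>b\<bar> \<le> a\<^sup>2 - b\<^sup>2"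
    using assms by (simp add: abs_mult Re_power2 Im_power2 a_def b_def)
  have b: "2 * \<bar>b\<bar> \<le> a"
  proof (rule ccontr)
    assume *: "\<not> 2 * \<bar>b\<bar> \<le> a"
    hence "a * a \<le> a * (2 * \<bar>b\<bar>)" using a by (intro mult_left_mono) auto
    moreover have "b\<^sup>2 > 0" using * a by auto
    ultimately show False using le by (simp add: power2_eq_square)
  qed
  hence "(2 * \<bar>b\<bar>)\<^sup>2 \<le> a\<^sup>2" by (intro power_mono) auto
  hence b2: "4 * b\<^sup>2 \<le> a\<^sup>2" by (simp add: power_mult_distrib)
  have "Re (v ^ 3) = a * (a\<^sup>2 - 3 * b\<^sup>2)"
    by (simp add: a_def b_def power3_eq_cube power2_eq_square algebra_simps)
  also have "\<dots> \<ge> a * (a\<^sup>2 / 4)" using a b2 by (intro mult_left_mono) auto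
  finally show "Re (v ^ 3) \<ge> Re v ^ 3 / 4"
    by (simp add: a_def power3_eq_cube power2_eq_square)
  have "norm (v\<^sup>2) = a\<^sup>2 + b\<^sup>2" by (simp add: norm_power cmod_power2 a_def b_def)
  thus "norm (v\<^sup>2) \<le> 2 * (Re v)\<^sup>2" using b2 zero_le_power2[of b] unfolding a_def by linarith
qed

text \<open>The factor \<open>exp (- \<epsilon> (1 + z)\<^bsup>3/2\<^esup>)\<close> beats any growth of order one inside
  the sector and is bounded by one there; the shift by one avoids the branch point.\<close>

lemma Phragmen_Lindelof_sector:
  assumes hol: "h holomorphic_on UNIV"
    and growth: "\<And>z. norm (h z) \<le> C * exp (c * norm z)"
    and "B > 0" and bdry: "\<And>z. \<bar>Im z\<bar> = Re z \<Longrightarrow> norm (h z) \<le> B"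
    and z: "\<bar>Im z\<bar> \<le> Re z"
  shows "norm (h z) \<le> B"
proof -
  let ?S = "{z. \<bar>Im z\<bar> \<le> Re z}" and ?U = "{z. Re z > -1}"
  define C' where "C' = max C 1"
  define c' where "c' = max c 0"
  have "C' > 0" "c' \<ge> 0" by (auto simp: C'_def c'_def)
  have growth': "norm (h z) \<le> C' * exp (c' * norm z)" for z
    by (rule order_trans[OF growth])
       (auto intro!: mult_mono mult_right_mono simp: C'_def c'_def)
  have re: "Re (csqrt (1 + z) ^ 3) \<ge> Re (csqrt (1 + z)) ^ 3 / 4"
       "norm z \<le> 2 * (Re (csqrt (1 + z)))\<^sup>2" if "z \<in> ?S" for z
  proof -
    \<comment> \<open>Adding 1 keeps a point in the sector, and squaring \<open>csqrt\<close>
      returns \<open>1 + z\<close>.\<close>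
    have "\<bar>Im ((csqrt (1 + z))\<^sup>2)\<bar> \<le> Re ((csqrt (1 + z))\<^sup>2)" using that by auto
    note * = Re_cubed_ge[OF Re_csqrt this]
    show "Re (csqrt (1 + z) ^ 3) \<ge> Re (csqrt (1 + z)) ^ 3 / 4" by fact
    have "norm z \<le> norm (1 + z)"
      using that power_mono[of "Re z" "1 + Re z" 2] by (auto simp: norm_complex_def)
    with *(2) show "norm z \<le> 2 * (Re (csqrt (1 + z)))\<^sup>2" by (simp del: csqrt.sel)
  qed
  have bound: "norm (h z * exp (- (of_real \<epsilon> * csqrt (1 + z) ^ 3))) \<le> B" if "\<epsilon> > 0" for \<epsilon>
  proof -
    \<comment> \<open>\<open>K\<close> makes \<open>C' * exp (- K) \<le> B\<close>. \<open>A\<close>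
      is such that \<open>a = Re (csqrt (1 + z)) \<ge> A\<close> makes the damping exponent
      \<open>\<epsilon> * a ^ 3 / 4\<close> exceed the growth exponent
      \<open>2 * c' * a\<^sup>2\<close> by at least \<open>K\<close>. Since
      \<open>norm z \<le> 2 * a\<^sup>2\<close>, this happens once
      \<open>norm z \<ge> 2 * A\<^sup>2\<close>.\<close>
    define K where "K = max 0 (ln (C' / B))"
    define A where "A = max 1 (4 * (2 * c' + K) / \<epsilon>)"
    have expK: "C' * exp (- K) \<le> B"
    proof -
      have "exp (- K) \<le> exp (- ln (C' / B))" by (simp add: K_def)
      also have "\<dots> = B / C'" using \<open>C' > 0\<close> \<open>B > 0\<close> by (simp add: exp_minus)
      finally show ?thesis using \<open>C' > 0\<close> by (simp add: field_simps)
    qed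
    have damp: "norm (exp (- (of_real \<epsilon> * csqrt (1 + z) ^ 3))) \<le> exp (- (\<epsilon> * Re (csqrt (1 + z)) ^ 3 / 4))"
      if "z \<in> ?S" for z
      using mult_left_mono[OF re(1)[OF that], of \<epsilon>] \<open>\<epsilon> > 0\<close> by simp
    show ?thesis
    proof (rule norm_le_on_closed_set[where S = ?S and U = ?U and \<xi> = z
          and u = "\<lambda>z. h z * exp (- (of_real \<epsilon> * csqrt (1 + z) ^ 3))" and R = "2 * A\<^sup>2"])
      show "open ?U" by (simp add: open_halfspace_Re_gt)
      show "closed ?S" by (intro closed_Collect_le continuous_intros)
      show "?S \<subseteq> ?U" by auto
      have "1 + z \<notin> \<real>\<^sub>\<le>\<^sub>0" if "z \<in> ?U" for z
        using that by (auto simp: complex_nonpos_Reals_iff)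
      thus "(\<lambda>z. h z * exp (- (of_real \<epsilon> * csqrt (1 + z) ^ 3))) holomorphic_on ?U"
        by (intro holomorphic_intros holomorphic_on_subset[OF hol]) auto
      show "z \<in> ?S" using z by simp
    next
      fix z assume "z \<in> frontier ?S"
      moreover have "{z. \<bar>Im z\<bar> < Re z} \<subseteq> interior ?S"
        by (rule interior_maximal) (auto intro!: open_Collect_less continuous_intros)
      moreover have "closed ?S" by (intro closed_Collect_le continuous_intros)
      ultimately have z: "z \<in> ?S" "\<not> \<bar>Im z\<bar> < Re z"
        by (auto simp: frontier_def)
      hence "norm (h z) \<le> B" by (intro bdry) auto
      moreover have "norm (exp (- (of_real \<epsilon> * csqrt (1 + z) ^ 3))) \<le> 1"
        using \<open>\<epsilon> > 0\<close> Re_csqrt[of "1 + z"]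
        by (intro order_trans[OF damp[OF z(1)]]) (auto intro!: divide_nonneg_pos mult_nonneg_nonneg simp del: csqrt.sel)
      ultimately show "norm (h z * exp (- (of_real \<epsilon> * csqrt (1 + z) ^ 3))) \<le> B"
        unfolding norm_mult using \<open>B > 0\<close> mult_mono[of _ B _ 1] by fastforce
    next
      fix z assume z: "z \<in> ?S" "norm z \<ge> 2 * A\<^sup>2"
      define a where "a = Re (csqrt (1 + z))"
      have "A\<^sup>2 \<le> a\<^sup>2" using re(2)[OF z(1)] z(2) by (simp add: a_def)
      hence "A \<le> a" by (rule power2_le_imp_le) (simp only: a_def Re_csqrt)
      hence a: "a \<ge> 1" "2 * c' + K \<le> \<epsilon> * a / 4"
        using \<open>\<epsilon> > 0\<close> by (auto simp: A_def field_simps)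
      have "(2 * c' + K) * a\<^sup>2 \<le> (\<epsilon> * a / 4) * a\<^sup>2" using a by (intro mult_right_mono) auto
      moreover have "K * 1 \<le> K * a\<^sup>2" using a by (intro mult_left_mono) (auto simp: K_def)
      ultimately have "c' * (2 * a\<^sup>2) - \<epsilon> * a ^ 3 / 4 \<le> - K"
        by (simp add: power3_eq_cube power2_eq_square algebra_simps)
      moreover have "c' * norm z \<le> c' * (2 * a\<^sup>2)"
        using re(2)[OF z(1)] \<open>c' \<ge> 0\<close> by (intro mult_left_mono) (auto simp: a_def)
      ultimately have "c' * norm z + - (\<epsilon> * a ^ 3 / 4) \<le> - K" by linarith
      hence "C' * exp (c' * norm z) * exp (- (\<epsilon> * a ^ 3 / 4)) \<le> C' * exp (- K)"
        using \<open>C' > 0\<close> by (simp add: mult.assoc flip: exp_add)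
      moreover have "norm (h z * exp (- (of_real \<epsilon> * csqrt (1 + z) ^ 3)))
        \<le> C' * exp (c' * norm z) * exp (- (\<epsilon> * a ^ 3 / 4))"
        unfolding norm_mult using damp[OF z(1)] \<open>C' > 0\<close>
        by (intro mult_mono growth') (auto simp: a_def)
      ultimately show "norm (h z * exp (- (of_real \<epsilon> * csqrt (1 + z) ^ 3))) \<le> B"
        using expK by linarith
    qed
  qed
  have "((\<lambda>\<epsilon>. norm (h z * exp (- (of_real \<epsilon> * csqrt (1 + z) ^ 3)))) \<longlongrightarrow>
        norm (h z * exp (- (of_real 0 * csqrt (1 + z) ^ 3)))) (at_right 0)"
    by (intro tendsto_intros)
  moreover have "\<forall>\<^sub>F \<epsilon> in at_right 0. norm (h z * exp (- (of_real \<epsilon> * csqrt (1 + z) ^ 3))) \<le> B"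
    using bound by (auto simp: eventually_at_filter)
  ultimately show ?thesis
    by (auto dest!: tendsto_upperbound)
qed

text \<open>The factor \<open>exp (\<i> * of_real \<tau> * z)\<close> has norm one on the real axis
  and cancels the growth of \<open>g\<close> on the positive imaginary axis. The product is
  therefore bounded on the boundary of both upper quadrants, which are rotated sectors. This gives
  the bound \<open>B = max C M\<close>; a second comparison lowers it to \<open>M\<close>.\<close>

lemma Phragmen_Lindelof_upper_half_plane:
  assumes hol: "g holomorphic_on UNIV"
    and growth: "\<And>z. norm (g z) \<le> C * exp (\<tau> * norm z)"
    and "M > 0" and real: "\<And>x::real. norm (g (of_real x)) \<le> M"
    and "\<tau> \<ge> 0" and z: "Im z \<ge> 0"
  shows "norm (g z) \<le> M * exp (\<tau> * Im z)"
proof -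
  define h where "h z = g z * exp (\<i> * of_real \<tau> * z)" for z
  have h_hol: "h holomorphic_on A" for A
    unfolding h_def by (intro holomorphic_intros holomorphic_on_subset[OF hol]) auto
  have h_norm: "norm (h z) = norm (g z) * exp (- (\<tau> * Im z))" for z
    by (simp add: h_def norm_mult)
  define B where "B = max C M"
  have "B > 0" using \<open>M > 0\<close> by (simp add: B_def)
  have h_real: "norm (h z) \<le> M" if "Im z = 0" for z
  proof -
    have "z = of_real (Re z)" using that by (simp add: complex_eq_iff)
    thus ?thesis using real[of "Re z"] that by (simp add: h_norm)
  qed
  have h_imag: "norm (h z) \<le> B" if "Re z = 0" "Im z \<ge> 0" for z
  proof -
    have "norm z = Im z" using that by (simp add: norm_complex_def)
    hence "norm (h z) \<le> C * exp (\<tau> * Im z) * exp (- (\<tau> * Im z))"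
      using growth[of z] by (simp add: h_norm)
    thus ?thesis by (simp add: B_def mult.assoc flip: exp_add)
  qed
  \<comment> \<open>The rate \<open>2 * \<tau>\<close> is crude, but the sector principle accepts
    any rate.\<close>
  have h_growth: "norm (h z) \<le> C * exp ((2 * \<tau>) * norm z)" for z
  proof -
    have "- (\<tau> * Im z) \<le> \<tau> * norm z"
      using abs_Im_le_cmod[of z] \<open>\<tau> \<ge> 0\<close> by (metis abs_le_D2 minus_mult_right mult_left_mono)
    hence "norm (h z) \<le> (C * exp (\<tau> * norm z)) * exp (\<tau> * norm z)"
      unfolding h_norm by (intro mult_mono growth) (auto intro: order_trans[OF norm_ge_zero growth])
    thus ?thesis by (simp add: mult.assoc flip: exp_add)
  qed
  \<comment> \<open>Multiplication by \<open>1 + \<i>\<close> or \<open>-1 + \<i>\<close> carries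
    the sector onto the first or second quadrant, and its boundary rays onto the real and the
    positive imaginary axis.\<close>
  have sector: "norm (h (\<omega> * w)) \<le> B"
    if w: "\<bar>Im w\<bar> \<le> Re w" and \<omega>: "\<omega> = 1 + \<i> \<or> \<omega> = -1 + \<i>" for w \<omega>
  proof (rule Phragmen_Lindelof_sector[of "\<lambda>w. h (\<omega> * w)" C "2 * \<tau> * norm \<omega>"])
    show "(\<lambda>w. h (\<omega> * w)) holomorphic_on UNIV"
      using holomorphic_on_compose_gen[of "\<lambda>w. \<omega> * w" UNIV h UNIV] h_hol
      by (auto simp: o_def holomorphic_on_mult)
    show "norm (h (\<omega> * w)) \<le> C * exp (2 * \<tau> * norm \<omega> * norm w)" for w
      using h_growth[of "\<omega> * w"] by (simp add: norm_mult mult_ac)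
    show "norm (h (\<omega> * w)) \<le> B" if "\<bar>Im w\<bar> = Re w" for w
    proof (cases "Im (\<omega> * w) = 0")
      case True
      thus ?thesis using h_real by (fastforce simp: B_def)
    next
      case False
      hence "Re (\<omega> * w) = 0" "Im (\<omega> * w) \<ge> 0"
        using that \<omega> by (auto simp: abs_if split: if_splits)
      thus ?thesis by (rule h_imag)
    qed
  qed (use \<open>B > 0\<close> w in auto)
  have h_upper: "norm (h z) \<le> B" if "Im z \<ge> 0" for z
  proof (cases "Re z \<ge> 0")
    case True
    have "norm (h ((1 + \<i>) * (z / (1 + \<i>)))) \<le> B"
      using True that by (intro sector) (auto simp: Re_divide Im_divide abs_if field_simps)
    moreover have "1 + \<i> \<noteq> 0" by (auto simp: complex_eq_iff)
    ultimately show ?thesis by simp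
  next
    case False
    have "norm (h ((-1 + \<i>) * (z / (-1 + \<i>)))) \<le> B"
      using False that by (intro sector) (auto simp: Re_divide Im_divide abs_if field_simps)
    moreover have "-1 + \<i> \<noteq> 0" by (auto simp: complex_eq_iff)
    ultimately show ?thesis by simp
  qed
  let ?S = "{z. Im z \<ge> 0}"
  have ge1: "norm (1 - \<i> * of_real \<epsilon> * z) \<ge> 1" if "\<epsilon> > 0" "z \<in> ?S" for \<epsilon> z
    using complex_Re_le_cmod[of "1 - \<i> * of_real \<epsilon> * z"] that by (auto intro: order_trans[rotated])
  \<comment> \<open>Dividing by \<open>1 - \<i> * of_real \<epsilon> * z\<close>, of norm at least
    one and of linear growth in the half-plane, turns the bound \<open>B\<close> into
    \<open>M\<close> far out: there the divisor has norm at least \<open>B / M\<close>. On the real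
    axis \<open>M\<close> holds already, and \<open>\<epsilon>\<close> then tends to 0.\<close>
  have bound: "norm (h z / (1 - \<i> * of_real \<epsilon> * z)) \<le> M" if "\<epsilon> > 0" for \<epsilon>
  proof (rule norm_le_on_closed_set[where S = ?S and U = "{z. 1 - \<i> * of_real \<epsilon> * z \<noteq> 0}"
        and \<xi> = z and u = "\<lambda>z. h z / (1 - \<i> * of_real \<epsilon> * z)" and R = "(1 + B / M) / \<epsilon>"])
    show "open {z. 1 - \<i> * of_real \<epsilon> * z \<noteq> 0}" by (intro open_Collect_neq continuous_intros)
    show "closed ?S" by (simp add: closed_halfspace_Im_ge)
    show "?S \<subseteq> {z. 1 - \<i> * of_real \<epsilon> * z \<noteq> 0}" using ge1[OF that] by fastforce
    show "(\<lambda>z. h z / (1 - \<i> * of_real \<epsilon> * z)) holomorphic_on {z. 1 - \<i> * of_real \<epsilon> * z \<noteq> 0}"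
      by (intro holomorphic_intros h_hol) auto
    show "z \<in> ?S" using z by simp
  next
    fix z assume "z \<in> frontier ?S"
    moreover have "{z. Im z > 0} \<subseteq> interior ?S"
      by (rule interior_maximal) (auto simp: open_halfspace_Im_gt)
    moreover have "closed ?S" by (simp add: closed_halfspace_Im_ge)
    ultimately have "Im z = 0" "z \<in> ?S" by (force simp: frontier_def)+
    hence "norm (h z) \<le> M * 1" using h_real by simp
    also have "\<dots> \<le> M * norm (1 - \<i> * of_real \<epsilon> * z)"
      using ge1[OF that \<open>z \<in> ?S\<close>] \<open>M > 0\<close> by (intro mult_left_mono) auto
    finally show "norm (h z / (1 - \<i> * of_real \<epsilon> * z)) \<le> M"
      using ge1[OF that \<open>z \<in> ?S\<close>] \<open>M > 0\<close> by (simp add: norm_divide divide_le_eq)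
  next
    fix z assume z: "z \<in> ?S" "norm z \<ge> (1 + B / M) / \<epsilon>"
    have "norm (\<i> * of_real \<epsilon> * z) \<le> norm (1 - \<i> * of_real \<epsilon> * z) + 1"
      using norm_triangle_ineq4[of 1 "1 - \<i> * of_real \<epsilon> * z"] by simp
    hence "B / M \<le> norm (1 - \<i> * of_real \<epsilon> * z)"
      using z(2) that by (simp add: norm_mult field_simps)
    hence "B \<le> M * norm (1 - \<i> * of_real \<epsilon> * z)" using \<open>M > 0\<close> by (simp add: field_simps)
    with h_upper z(1) have "norm (h z) \<le> M * norm (1 - \<i> * of_real \<epsilon> * z)" by fastforce
    thus "norm (h z / (1 - \<i> * of_real \<epsilon> * z)) \<le> M"
      using ge1[OF that z(1)] \<open>M > 0\<close> by (simp add: norm_divide divide_le_eq)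
  qed
  have "((\<lambda>\<epsilon>. norm (h z / (1 - \<i> * of_real \<epsilon> * z))) \<longlongrightarrow>
        norm (h z / (1 - \<i> * of_real 0 * z))) (at_right 0)"
    by (intro tendsto_intros) auto
  moreover have "\<forall>\<^sub>F \<epsilon> in at_right 0. norm (h z / (1 - \<i> * of_real \<epsilon> * z)) \<le> M"
    using bound by (auto simp: eventually_at_filter)
  ultimately have "norm (h z) \<le> M" by (auto dest!: tendsto_upperbound)
  thus ?thesis by (simp add: h_norm exp_minus field_simps)
qed

lemma Phragmen_Lindelof_real_line:
  assumes hol: "g holomorphic_on UNIV"
    and growth: "\<And>z. norm (g z) \<le> C * exp (\<tau> * norm z)"
    and "M > 0" and real: "\<And>x::real. norm (g (of_real x)) \<le> M"
    and "\<tau> \<ge> 0"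
  shows "norm (g z) \<le> M * exp (\<tau> * \<bar>Im z\<bar>)"
proof (cases "Im z \<ge> 0")
  case True
  thus ?thesis using Phragmen_Lindelof_upper_half_plane[OF assms, of z] by simp
next
  case False
  have "norm (g (- (- z))) \<le> M * exp (\<tau> * Im (- z))"
  proof (rule Phragmen_Lindelof_upper_half_plane[of "\<lambda>z. g (- z)" C])
    show "(\<lambda>z. g (- z)) holomorphic_on UNIV"
      using holomorphic_on_compose_gen[of "\<lambda>z. - z" UNIV g UNIV] hol
      by (auto simp: o_def holomorphic_on_minus)
    show "norm (g (- z)) \<le> C * exp (\<tau> * norm z)" for z using growth[of "- z"] by simp
    show "norm (g (- of_real x)) \<le> M" for x using real[of "- x"] by simp
  qed (use False assms in auto)
  thus ?thesis using False by simp
qed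

text \<open>Exponential type gives the growth rate \<open>\<sigma> + \<epsilon>\<close> with a
  constant depending on \<open>\<epsilon>\<close>. The Phragmen-Lindelof bound has the constant
  \<open>M\<close> instead, so \<open>\<epsilon>\<close> may tend to 0.\<close>

lemma Phragmen_Lindelof_exp_type:
  assumes hol: "g holomorphic_on UNIV" and type: "exp_type_at_most \<sigma> g"
    and "M > 0" "\<sigma> \<ge> 0" and real: "\<And>x::real. norm (g (of_real x)) \<le> M"
  shows "norm (g z) \<le> M * exp (\<sigma> * \<bar>Im z\<bar>)"
proof -
  have "norm (g z) \<le> M * exp ((\<sigma> + \<epsilon>) * \<bar>Im z\<bar>)" if \<epsilon>: "\<epsilon> > 0" for \<epsilon>
  proof -
    obtain C where C: "\<And>z. norm (g z) \<le> C * exp ((\<sigma> + \<epsilon>) * norm z)"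
      using type \<epsilon> unfolding exp_type_at_most_def by blast
    show ?thesis
      using \<open>\<sigma> \<ge> 0\<close> \<epsilon> by (intro Phragmen_Lindelof_real_line[OF hol C \<open>M > 0\<close> real]) simp
  qed
  hence "\<forall>\<^sub>F \<epsilon> in at_right 0. norm (g z) \<le> M * exp ((\<sigma> + \<epsilon>) * \<bar>Im z\<bar>)"
    by (auto simp: eventually_at_filter)
  moreover have "((\<lambda>\<epsilon>. M * exp ((\<sigma> + \<epsilon>) * \<bar>Im z\<bar>)) \<longlongrightarrow> M * exp ((\<sigma> + 0) * \<bar>Im z\<bar>)) (at_right 0)"
    by (intro tendsto_intros)
  ultimately have "norm (g z) \<le> M * exp ((\<sigma> + 0) * \<bar>Im z\<bar>)"
    by (intro tendsto_lowerbound[of _ _ "at_right 0"]) auto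
  thus ?thesis by simp
qed

section \<open>Square-integrable entire functions of exponential type\<close>

lemma continuous_on_of_real_entire:
  assumes "f holomorphic_on UNIV"
  shows "continuous_on A (\<lambda>x::real. f (of_real x))"
  by (rule continuous_on_compose2[OF holomorphic_on_imp_continuous_on[OF assms]])
     (auto intro: continuous_intros)

text \<open>The integration runs over a compact interval and the differentiated integrand is jointly
  continuous, so Leibniz's rule applies. All derivatives fall on \<open>f\<close>; hence
  \<open>h\<close> may be the conjugate of a holomorphic function.\<close>

lemma entire_shift_has_field_derivative_integral:
  assumes hol: "f holomorphic_on UNIV" and h: "continuous_on {a..b::real} h"
  shows "((\<lambda>z. integral {a..b} (\<lambda>x. f (z + of_real x) * h x)) has_field_derivative
           integral {a..b} (\<lambda>x. deriv f (z + of_real x) * h x)) (at z)"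
proof -
  have "((\<lambda>z. integral (cbox a b) (\<lambda>x. f (z + of_real x) * h x)) has_field_derivative
           integral (cbox a b) (\<lambda>x. deriv f (z + of_real x) * h x)) (at z within UNIV)"
  proof (rule leibniz_rule_field_derivative)
    show "((\<lambda>z. f (z + of_real x) * h x) has_field_derivative deriv f (z + of_real x) * h x) (at z within UNIV)" for z x
    proof -
      have "((\<lambda>z. f (z + of_real x)) has_field_derivative deriv f (z + of_real x)) (at z)"
        using DERIV_shift[of f "deriv f (z + of_real x)" z "of_real x"]
          holomorphic_derivI[OF hol open_UNIV UNIV_I, of "z + of_real x" UNIV] by (rule iffD1)
      thus ?thesis by (rule DERIV_cmult_right)
    qed
    have "continuous_on {a..b} (\<lambda>x. f (z + of_real x))" for z
      by (rule continuous_on_compose2[OF holomorphic_on_imp_continuous_on[OF hol]])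
         (auto intro!: continuous_intros)
    thus "(\<lambda>x. f (z + of_real x) * h x) integrable_on cbox a b" for z
      using h by (auto intro!: integrable_continuous_real continuous_on_mult)
    have "continuous_on (UNIV \<times> {a..b}) (\<lambda>p. deriv f (fst p + of_real (snd p)))"
      by (rule continuous_on_compose2[OF holomorphic_on_imp_continuous_on[OF holomorphic_deriv[OF hol open_UNIV]]])
         (auto intro!: continuous_intros)
    moreover have "continuous_on (UNIV \<times> {a..b}) (\<lambda>p. h (snd p))"
      by (rule continuous_on_compose2[OF h]) (auto intro!: continuous_intros)
    ultimately show "continuous_on (UNIV \<times> cbox a b) (\<lambda>(z, x). deriv f (z + of_real x) * h x)"
      unfolding case_prod_unfold by (auto intro!: continuous_on_mult)
  qed auto
  thus ?thesis by simp
qed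

lemma higher_deriv_integral_entire_shift:
  assumes hol: "f holomorphic_on UNIV" and h: "continuous_on {a..b::real} h"
  shows "(deriv ^^ n) (\<lambda>z. integral {a..b} (\<lambda>x. f (z + of_real x) * h x)) =
           (\<lambda>z. integral {a..b} (\<lambda>x. (deriv ^^ n) f (z + of_real x) * h x))"
proof (induction n)
  case (Suc n)
  have "(deriv ^^ n) f holomorphic_on UNIV" using hol by (intro holomorphic_higher_deriv) auto
  from entire_shift_has_field_derivative_integral[OF this h] Suc show ?case
    by (auto intro!: DERIV_imp_deriv ext)
qed simp

section \<open>From bounded intervals to the real line\<close>

lemma integral_Icc_le_integral_lborel:
  fixes F :: "real \<Rightarrow> real"
  assumes "integrable lborel F" "\<And>x. F x \<ge> 0"
  shows "integral {a..b} F \<le> integral\<^sup>L lborel F"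
proof -
  have "set_integrable lborel {a..b} F"
    unfolding set_integrable_def using assms by (intro integrable_mult_indicator) auto
  from set_borel_integral_eq_integral(2)[OF this]
  have "integral {a..b} F = (LINT x|lborel. indicator {a..b} x *\<^sub>R F x)"
    by (simp add: set_lebesgue_integral_def)
  also have "\<dots> \<le> integral\<^sup>L lborel F"
    using assms by (intro integral_mono integrable_mult_indicator) (auto simp: indicator_def)
  finally show ?thesis .
qed

text \<open>Monotone convergence along the intervals from \<open>- real n\<close> to
  \<open>real n\<close>, with integrals bounded by \<open>B\<close> uniformly.\<close>

lemma integrable_lborel_of_bounded_Icc:
  fixes F :: "real \<Rightarrow> real"
  assumes cont: "continuous_on UNIV F" and nonneg: "\<And>x. F x \<ge> 0"
    and bound: "\<And>T. integral {-T..T} F \<le> B"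
  shows "integrable lborel F" "integral\<^sup>L lborel F \<le> B"
proof -
  define G where "G n x = indicator {- real n..real n} x *\<^sub>R F x" for n :: nat and x :: real
  have int: "integrable lborel (G n)" for n
    using borel_integrable_atLeastAtMost'[of "- real n" "real n" F] continuous_on_subset[OF cont]
    by (auto simp: G_def[abs_def] set_integrable_def)
  have G_bound: "integral\<^sup>L lborel (G n) \<le> B" for n
    using set_borel_integral_eq_integral(2)[of "{- real n..real n}" F] int[of n] bound[of "real n"]
    by (simp add: G_def[abs_def] set_integrable_def set_lebesgue_integral_def)
  have mono: "G n x \<le> G m x" if "n \<le> m" for n m x
    using that nonneg by (auto simp: G_def indicator_def)
  have "incseq (\<lambda>n. integral\<^sup>L lborel (G n))"
    by (intro incseq_SucI integral_mono int mono) auto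
  then obtain L where L: "(\<lambda>n. integral\<^sup>L lborel (G n)) \<longlonglongrightarrow> L"
    using G_bound incseq_convergent by blast
  have lim: "(\<lambda>n. G n x) \<longlonglongrightarrow> F x" for x
  proof (rule tendsto_eventually)
    obtain N :: nat where "\<bar>x\<bar> \<le> real N" using real_arch_simple by blast
    thus "\<forall>\<^sub>F n in sequentially. G n x = F x"
      by (intro eventually_sequentiallyI[of N]) (auto simp: G_def indicator_def)
  qed
  have meas: "F \<in> borel_measurable lborel" using cont by (simp add: borel_measurable_continuous_onI)
  show "integrable lborel F"
    by (rule integrable_monotone_convergence[OF int _ _ L meas]) (auto simp: incseq_def mono lim)
  have "integral\<^sup>L lborel F = L"
    by (rule integral_monotone_convergence[OF int _ _ L meas]) (auto simp: incseq_def mono lim)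
  thus "integral\<^sup>L lborel F \<le> B" using L G_bound LIMSEQ_le_const2 by blast
qed

text \<open>Duality: the derivative is tested against itself on a bounded interval, so that the
  sup-norm bound of Cauchy's inequality for the correlation \<open>g\<close> becomes an \<open>L\<^sup>2\<close> bound.\<close>

lemma integral_Icc_higher_deriv_le:
  assumes "\<sigma> \<ge> 0" and hol: "f holomorphic_on UNIV" and type: "exp_type_at_most \<sigma> f"
    and L2: "square_integrable_real_line f" and "r > 0"
  shows "integral {-T..T} (\<lambda>x. (norm ((deriv ^^ k) f (of_real x)))\<^sup>2)
           \<le> (fact k * exp (\<sigma> * r) / r ^ k)\<^sup>2 * sq_integral f"
proof -
  \<comment> \<open>\<open>K\<close> collects Cauchy's constant on the circle of radius
    \<open>r\<close> and the factor \<open>exp (\<sigma> * r)\<close> that bounds the growth there.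
    \<open>M\<close> comes from \<open>p * q \<le> (K * p\<^sup>2 + q\<^sup>2 / K) / 2\<close>,
    weighted so that \<open>K * M\<close> contains exactly half of \<open>A\<close>, which can be
    absorbed.\<close>
  define K where "K = fact k * exp (\<sigma> * r) / r ^ k"
  define h where "h x = cnj ((deriv ^^ k) f (of_real x))" for x :: real
  define g where "g z = integral {-T..T} (\<lambda>x. f (z + of_real x) * h x)" for z
  define A where "A = integral {-T..T} (\<lambda>x. (norm ((deriv ^^ k) f (of_real x)))\<^sup>2)"
  define M where "M = (K * sq_integral f + A / K) / 2"
  have "K > 0" using \<open>r > 0\<close> by (simp add: K_def)
  have "sq_integral f \<ge> 0" by (simp add: sq_integral_def)
  have hol_k: "(deriv ^^ k) f holomorphic_on UNIV" using hol by (intro holomorphic_higher_deriv) auto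
  have cont_h: "continuous_on S h" for S
    unfolding h_def by (intro continuous_intros continuous_on_of_real_entire hol_k)
  have cont_f: "continuous_on S (\<lambda>x. f (z + of_real x))" for S z
    by (rule continuous_on_compose2[OF holomorphic_on_imp_continuous_on[OF hol]])
       (auto intro!: continuous_intros)
  \<comment> \<open>Positivity of \<open>A\<close> makes \<open>M\<close> positive, as
    Phragmen-Lindelof requires; otherwise the bound is trivial.\<close>
  have "A \<le> K\<^sup>2 * sq_integral f" if "A > 0"
  proof -
    have "M > 0" using that \<open>K > 0\<close> \<open>sq_integral f \<ge> 0\<close> by (simp add: M_def add_nonneg_pos)
    have g_hol: "g holomorphic_on UNIV"
      using entire_shift_has_field_derivative_integral[OF hol cont_h]
      unfolding holomorphic_on_def field_differentiable_def g_def by fastforce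
    have g_type: "exp_type_at_most \<sigma> g"
      unfolding exp_type_at_most_def
    proof safe
      fix \<epsilon> :: real assume "\<epsilon> > 0"
      then obtain C where C: "C > 0" "\<And>z. norm (f z) \<le> C * exp ((\<sigma> + \<epsilon>) * norm z)"
        using type unfolding exp_type_at_most_def by blast
      let ?H = "integral {-T..T} (\<lambda>x. norm (h x))"
      let ?D = "C * exp ((\<sigma> + \<epsilon>) * T)"
      \<comment> \<open>The summand 1 keeps the constant positive even if \<open>?H\<close>
        vanishes.\<close>
      have "norm (g z) \<le> (?D * ?H + 1) * exp ((\<sigma> + \<epsilon>) * norm z)" for z
      proof -
        have "norm (g z) \<le> integral {-T..T} (\<lambda>x. ?D * exp ((\<sigma> + \<epsilon>) * norm z) * norm (h x))"
          unfolding g_def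
        proof (rule integral_norm_bound_integral)
          show "(\<lambda>x. f (z + of_real x) * h x) integrable_on {-T..T}"
            by (intro integrable_continuous_real continuous_intros cont_f cont_h)
          show "(\<lambda>x. ?D * exp ((\<sigma> + \<epsilon>) * norm z) * norm (h x)) integrable_on {-T..T}"
            by (intro integrable_continuous_real continuous_intros cont_h)
          fix x assume "x \<in> {-T..T}"
          hence "norm (z + of_real x) \<le> T + norm z"
            using norm_triangle_ineq[of z "of_real x"] by auto
          hence "norm (f (z + of_real x)) \<le> C * exp ((\<sigma> + \<epsilon>) * (T + norm z))"
            using \<open>\<sigma> \<ge> 0\<close> \<open>\<epsilon> > 0\<close> \<open>C > 0\<close>
            by (intro order_trans[OF C(2)]) (auto intro!: mult_left_mono)
          also have "\<dots> = ?D * exp ((\<sigma> + \<epsilon>) * norm z)"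
            by (simp add: distrib_left exp_add)
          finally show "norm (f (z + of_real x) * h x) \<le> ?D * exp ((\<sigma> + \<epsilon>) * norm z) * norm (h x)"
            unfolding norm_mult by (intro mult_right_mono) auto
        qed
        also have "\<dots> = ?D * ?H * exp ((\<sigma> + \<epsilon>) * norm z)" by simp
        also have "\<dots> \<le> (?D * ?H + 1) * exp ((\<sigma> + \<epsilon>) * norm z)"
          by (intro mult_right_mono) auto
        finally show ?thesis .
      qed
      moreover have "?D * ?H + 1 > 0"
        using \<open>C > 0\<close> by (intro add_nonneg_pos mult_nonneg_nonneg integral_nonneg
            integrable_continuous_real continuous_intros cont_h) auto
      ultimately show "\<exists>C>0. \<forall>z. norm (g z) \<le> C * exp ((\<sigma> + \<epsilon>) * norm z)" by blast
    qed
    have g_real: "norm (g (of_real t)) \<le> M" for t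
    proof -
      have "norm (g (of_real t)) \<le> integral {-T..T} (\<lambda>x.
              (K * (norm (f (of_real t + of_real x)))\<^sup>2 + (norm ((deriv ^^ k) f (of_real x)))\<^sup>2 / K) / 2)"
        unfolding g_def
      proof (rule integral_norm_bound_integral)
        show "(\<lambda>x. f (of_real t + of_real x) * h x) integrable_on {-T..T}"
          by (intro integrable_continuous_real continuous_intros cont_f cont_h)
        show "(\<lambda>x. (K * (norm (f (of_real t + of_real x)))\<^sup>2
                + (norm ((deriv ^^ k) f (of_real x)))\<^sup>2 / K) / 2) integrable_on {-T..T}"
          using \<open>K > 0\<close>
          by (intro integrable_continuous_real continuous_intros cont_f continuous_on_of_real_entire hol_k) auto
        fix x :: real
        define p q where "p = norm (f (of_real t + of_real x))" and "q = norm ((deriv ^^ k) f (of_real x))"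
        have "0 \<le> (K * p - q)\<^sup>2 / K" using \<open>K > 0\<close> by simp
        hence "p * q \<le> (K * p\<^sup>2 + q\<^sup>2 / K) / 2"
          using \<open>K > 0\<close> by (simp add: power2_eq_square field_simps)
        thus "norm (f (of_real t + of_real x) * h x) \<le> (K * (norm (f (of_real t + of_real x)))\<^sup>2
                + (norm ((deriv ^^ k) f (of_real x)))\<^sup>2 / K) / 2"
          by (simp add: norm_mult h_def p_def q_def)
      qed
      also have "\<dots> = (K * integral {-T..T} (\<lambda>x. (norm (f (of_real t + of_real x)))\<^sup>2) + A / K) / 2"
        unfolding A_def using \<open>K > 0\<close>
        by (subst integral_divide, subst Henstock_Kurzweil_Integration.integral_add)
           (auto intro!: integrable_continuous_real continuous_intros cont_f continuous_on_of_real_entire hol_k)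
      \<comment> \<open>Translation invariance of Lebesgue measure makes the bound on the real axis
        uniform in \<open>t\<close>.\<close>
      also have "integral {-T..T} (\<lambda>x. (norm (f (of_real t + of_real x)))\<^sup>2) \<le> sq_integral f"
      proof -
        let ?F = "\<lambda>x::real. (norm (f (of_real x)))\<^sup>2"
        have "integrable lborel ?F" using L2 by (simp add: square_integrable_real_line_def)
        from lborel_integrable_real_affine[OF this, of 1 t] 
        have "integral {-T..T} (\<lambda>x. ?F (t + 1 * x)) \<le> (LINT x|lborel. ?F (t + 1 * x))"
          by (intro integral_Icc_le_integral_lborel) auto
        also have "\<dots> = sq_integral f"
          using lborel_integral_real_affine[of 1 ?F t] by (simp add: sq_integral_def)
        finally show ?thesis by simp
      qed
      finally show ?thesis using \<open>K > 0\<close> by (simp add: M_def)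
    qed
    have "norm (g z) \<le> M * exp (\<sigma> * r)" if "norm (0 - z) = r" for z
    proof -
      have "\<sigma> * \<bar>Im z\<bar> \<le> \<sigma> * r"
        using that abs_Im_le_cmod[of z] \<open>\<sigma> \<ge> 0\<close> by (intro mult_left_mono) auto
      hence "M * exp (\<sigma> * \<bar>Im z\<bar>) \<le> M * exp (\<sigma> * r)" using \<open>M > 0\<close> by simp
      with Phragmen_Lindelof_exp_type[OF g_hol g_type \<open>M > 0\<close> \<open>\<sigma> \<ge> 0\<close> g_real, of z]
      show ?thesis by linarith
    qed
    hence "norm ((deriv ^^ k) g 0) \<le> fact k * (M * exp (\<sigma> * r)) / r ^ k"
      using \<open>r > 0\<close> by (intro Cauchy_inequality holomorphic_on_subset[OF g_hol]
          holomorphic_on_imp_continuous_on) auto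
    also have "\<dots> = K * M" by (simp add: K_def)
    \<comment> \<open>At 0 the differentiated correlation pairs the \<open>k\<close>-th derivative
      with its own conjugate \<open>h\<close>.\<close>
    also have "(deriv ^^ k) g 0 = of_real A"
    proof -
      have "(deriv ^^ k) g 0 = integral {-T..T} (\<lambda>x. (deriv ^^ k) f (of_real x) * h x)"
        unfolding g_def using higher_deriv_integral_entire_shift[OF hol cont_h, of k] by simp
      also have "\<dots> = integral {-T..T} (\<lambda>x. of_real ((norm ((deriv ^^ k) f (of_real x)))\<^sup>2))"
        by (simp only: h_def complex_norm_square)
      also have "\<dots> = of_real A"
        unfolding A_def
        by (intro integral_unique has_integral_of_real integrable_integral integrable_continuous_real
            continuous_intros continuous_on_of_real_entire hol_k)
      finally show ?thesis .
    qed
    finally have "A \<le> K * M" using that by simp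
    also have "K * M = (K\<^sup>2 * sq_integral f + A) / 2"
      using \<open>K > 0\<close> by (simp add: M_def power2_eq_square field_simps)
    finally show ?thesis by simp
  qed
  moreover have "0 \<le> K\<^sup>2 * sq_integral f" using \<open>sq_integral f \<ge> 0\<close> by simp
  ultimately have "A \<le> K\<^sup>2 * sq_integral f" by linarith
  thus ?thesis by (simp add: A_def K_def)
qed

section \<open>Integration by parts on the real line\<close>

lemma tendsto_at_top_integrable_imp_0:
  fixes H :: "real \<Rightarrow> real"
  assumes int: "integrable lborel H" and lim: "(H \<longlongrightarrow> c) at_top"
  shows "c = 0"
proof (rule ccontr)
  assume "c \<noteq> 0"
  define d where "d = \<bar>c\<bar> / 2"
  have "d > 0" "d < \<bar>c\<bar>" using \<open>c \<noteq> 0\<close> by (auto simp: d_def)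
  have "((\<lambda>x. \<bar>H x\<bar>) \<longlongrightarrow> \<bar>c\<bar>) at_top" using lim by (intro tendsto_intros)
  from order_tendstoD(1)[OF this \<open>d < \<bar>c\<bar>\<close>]
  obtain X where X: "\<And>x. x \<ge> X \<Longrightarrow> \<bar>H x\<bar> > d" unfolding eventually_at_top_linorder by blast
  \<comment> \<open>Beyond \<open>X\<close> an interval of length \<open>n\<close> contributes at
    least \<open>n * d\<close>, more than the whole integral of
    \<open>\<bar>H x\<bar>\<close>.\<close>
  obtain n :: nat where n: "real n > (LINT x|lborel. \<bar>H x\<bar>) / d" using reals_Archimedean2 by blast
  have "(LINT x|lborel. indicator {X..X + real n} x * d) \<le> (LINT x|lborel. \<bar>H x\<bar>)"
  proof (rule integral_mono)
    show "indicator {X..X + real n} x * d \<le> \<bar>H x\<bar>" for x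
      using X[of x] by (auto simp: indicator_def)
  qed (use int in auto)
  hence "real n * d \<le> (LINT x|lborel. \<bar>H x\<bar>)" by simp
  with n \<open>d > 0\<close> show False by (simp add: field_simps)
qed

text \<open>The difference \<open>G y - G (- y)\<close> tends to the integral of \<open>G'\<close>,
  and it is itself integrable in \<open>y\<close>, so its limit can only be 0. Integrability of
  \<open>G\<close> thus does the work of decay at infinity.\<close>

lemma integral_lborel_derivative_eq_0:
  fixes G G' :: "real \<Rightarrow> real"
  assumes deriv: "\<And>x. (G has_vector_derivative G' x) (at x)" and cont: "continuous_on UNIV G'"
    and int: "integrable lborel G" "integrable lborel G'"
  shows "integral\<^sup>L lborel G' = 0"
proof (rule tendsto_at_top_integrable_imp_0)
  show "integrable lborel (\<lambda>x. G x - G (- x))"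
    using int(1) lborel_integrable_real_affine[OF int(1), of "-1" 0] by auto
  have meas: "G' \<in> borel_measurable borel" using cont by (rule borel_measurable_continuous_onI)
  have "((\<lambda>y. LINT x|lborel. indicator {- y..y} x *\<^sub>R G' x) \<longlongrightarrow> integral\<^sup>L lborel G') at_top"
  proof (rule integral_dominated_convergence_at_top[where w = "\<lambda>x. norm (G' x)"])
    have "\<forall>\<^sub>F y in at_top. indicator {- y..y} x *\<^sub>R G' x = G' x" for x
      using eventually_ge_at_top[of "\<bar>x\<bar>"] by eventually_elim (auto simp: indicator_def)
    thus "AE x in lborel. ((\<lambda>y. indicator {- y..y} x *\<^sub>R G' x) \<longlongrightarrow> G' x) at_top"
      by (intro AE_I2 tendsto_eventually)
  qed (use int meas in \<open>auto simp: indicator_def\<close>)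
  moreover have "(LINT x|lborel. indicator {- y..y} x *\<^sub>R G' x) = G y - G (- y)" if "y \<ge> 0" for y
    using that
    by (intro integral_FTC_atLeastAtMost has_vector_derivative_at_within[OF deriv]
        continuous_on_subset[OF cont]) auto
  hence "\<forall>\<^sub>F y in at_top. (LINT x|lborel. indicator {- y..y} x *\<^sub>R G' x) = G y - G (- y)"
    by (intro eventually_at_top_linorderI[of 0])
  ultimately show "((\<lambda>y. G y - G (- y)) \<longlongrightarrow> integral\<^sup>L lborel G') at_top"
    by (rule Lim_transform_eventually)
qed

lemma integrable_inner_square_integrable:
  assumes "square_integrable_real_line f" "square_integrable_real_line g"
  shows "integrable lborel (\<lambda>x::real. inner (f (of_real x)) (g (of_real x)))"
proof (rule Bochner_Integration.integrable_bound)
  show "integrable lborel (\<lambda>x::real. (norm (f (of_real x)))\<^sup>2 + (norm (g (of_real x)))\<^sup>2)"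
    using assms by (auto simp: square_integrable_real_line_def)
  show "(\<lambda>x::real. inner (f (of_real x)) (g (of_real x))) \<in> borel_measurable lborel"
    using assms unfolding square_integrable_real_line_def by (intro borel_measurable_inner) auto
  have "\<bar>inner u v\<bar> \<le> (norm u)\<^sup>2 + (norm v)\<^sup>2" for u v :: complex
  proof -
    have "\<bar>inner u v\<bar> \<le> norm u * norm v" by (rule Cauchy_Schwarz_ineq2)
    also have "\<dots> \<le> (norm u)\<^sup>2 + (norm v)\<^sup>2"
      using sum_squares_bound[of "norm u" "norm v"]
        mult_nonneg_nonneg[OF norm_ge_zero[of u] norm_ge_zero[of v]] by linarith
    finally show ?thesis .
  qed
  thus "AE x in lborel. norm (inner (f (of_real x)) (g (of_real x)))
          \<le> norm ((norm (f (of_real x)))\<^sup>2 + (norm (g (of_real x)))\<^sup>2)"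
    by auto
qed

lemma sq_integral_nonneg: "sq_integral f \<ge> 0"
  by (simp add: sq_integral_def)

text \<open>Expanding the square leaves the cross term \<open>2 * c * inner f f''\<close>. The
  derivative of \<open>inner f f'\<close> is \<open>inner f f''\<close> plus the square of the norm
  of \<open>f'\<close> and integrates to 0, so the cross term becomes
  \<open>- 2 * c * sq_integral (deriv f)\<close>. This identity yields both the log-convexity behind
  Bernstein's inequality and the induction on \<open>N\<close>.\<close>

lemma
  assumes hol: "f holomorphic_on UNIV" and L2: "square_integrable_real_line f"
    "square_integrable_real_line (deriv f)" "square_integrable_real_line (deriv (deriv f))"
  shows square_integrable_add_deriv2:
      "square_integrable_real_line (\<lambda>z. of_real c * f z + deriv (deriv f) z)"
    and sq_integral_add_deriv2:
      "sq_integral (\<lambda>z. of_real c * f z + deriv (deriv f) z) =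
         c\<^sup>2 * sq_integral f - 2 * c * sq_integral (deriv f) + sq_integral (deriv (deriv f))"
proof -
  have hol1: "deriv f holomorphic_on UNIV" and hol2: "deriv (deriv f) holomorphic_on UNIV"
    using hol by (intro holomorphic_deriv; auto)+
  let ?f = "\<lambda>x::real. f (of_real x)" and ?f' = "\<lambda>x::real. deriv f (of_real x)"
    and ?f'' = "\<lambda>x::real. deriv (deriv f) (of_real x)"
  have int: "integrable lborel (\<lambda>x. (norm (?f x))\<^sup>2)" "integrable lborel (\<lambda>x. (norm (?f' x))\<^sup>2)"
      "integrable lborel (\<lambda>x. (norm (?f'' x))\<^sup>2)" "integrable lborel (\<lambda>x. inner (?f x) (?f'' x))"
      "integrable lborel (\<lambda>x. inner (?f x) (?f' x))"
    using L2 integrable_inner_square_integrable[OF L2(1) L2(3)]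
      integrable_inner_square_integrable[OF L2(1) L2(2)]
    by (auto simp: square_integrable_real_line_def)
  have expand: "(norm (of_real c * u + v))\<^sup>2 = c\<^sup>2 * (norm u)\<^sup>2 + 2 * c * inner u v + (norm v)\<^sup>2"
    for u v :: complex
  proof -
    have "of_real c * u = c *\<^sub>R u" by (simp add: scaleR_conv_of_real)
    thus ?thesis
      unfolding power2_norm_eq_inner
      by (simp add: inner_add_left inner_add_right inner_commute power2_eq_square algebra_simps)
  qed
  have "(LINT x|lborel. inner (?f x) (?f'' x) + (norm (?f' x))\<^sup>2) = 0"
  proof (rule integral_lborel_derivative_eq_0)
    show "((\<lambda>x. inner (?f x) (?f' x)) has_vector_derivative
             inner (?f x) (?f'' x) + (norm (?f' x))\<^sup>2) (at x)" for x
      unfolding power2_norm_eq_inner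
      by (intro bounded_bilinear.has_vector_derivative[OF bounded_bilinear_inner]
          has_vector_derivative_real_field holomorphic_derivI[OF hol] holomorphic_derivI[OF hol1]) auto
    show "continuous_on UNIV (\<lambda>x. inner (?f x) (?f'' x) + (norm (?f' x))\<^sup>2)"
      by (intro continuous_intros continuous_on_of_real_entire hol hol1 hol2)
  qed (use int in auto)
  hence parts: "(LINT x|lborel. inner (?f x) (?f'' x)) = - sq_integral (deriv f)"
    using int by (simp add: sq_integral_def)
  show "square_integrable_real_line (\<lambda>z. of_real c * f z + deriv (deriv f) z)"
    using L2 int unfolding square_integrable_real_line_def expand by auto
  show "sq_integral (\<lambda>z. of_real c * f z + deriv (deriv f) z) =
         c\<^sup>2 * sq_integral f - 2 * c * sq_integral (deriv f) + sq_integral (deriv (deriv f))"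
    using int parts unfolding sq_integral_def expand by simp
qed

section \<open>Derivatives: exponential type and square integrability\<close>

lemma exp_type_at_most_deriv:
  assumes hol: "f holomorphic_on UNIV" and type: "exp_type_at_most \<sigma> f" and "\<sigma> \<ge> 0"
  shows "exp_type_at_most \<sigma> (deriv f)"
  unfolding exp_type_at_most_def
proof safe
  fix \<epsilon> :: real assume "\<epsilon> > 0"
  then obtain C where C: "C > 0" "\<And>z. norm (f z) \<le> C * exp ((\<sigma> + \<epsilon>) * norm z)"
    using type unfolding exp_type_at_most_def by blast
  have "norm (deriv f z) \<le> C * exp (\<sigma> + \<epsilon>) * exp ((\<sigma> + \<epsilon>) * norm z)" for z
  proof -
    \<comment> \<open>Cauchy's inequality on the unit circle around \<open>z\<close> costs only the
      factor \<open>exp (\<sigma> + \<epsilon>)\<close>.\<close>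
    have "norm (f w) \<le> C * exp ((\<sigma> + \<epsilon>) * (1 + norm z))" if "norm (z - w) = 1" for w
    proof -
      have "norm w \<le> 1 + norm z" using norm_triangle_ineq3[of w z] that by (simp add: norm_minus_commute)
      thus ?thesis using \<open>C > 0\<close> \<open>\<sigma> \<ge> 0\<close> \<open>\<epsilon> > 0\<close>
        by (intro order_trans[OF C(2)]) (auto intro!: mult_left_mono)
    qed
    hence "norm ((deriv ^^ 1) f z) \<le> fact 1 * (C * exp ((\<sigma> + \<epsilon>) * (1 + norm z))) / 1 ^ 1"
      by (intro Cauchy_inequality holomorphic_on_subset[OF hol] holomorphic_on_imp_continuous_on) auto
    thus ?thesis by (simp add: distrib_left exp_add)
  qed
  thus "\<exists>C>0. \<forall>z. norm (deriv f z) \<le> C * exp ((\<sigma> + \<epsilon>) * norm z)"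
    using \<open>C > 0\<close> by (intro exI[of _ "C * exp (\<sigma> + \<epsilon>)"]) auto
qed

lemma exp_type_at_most_cmult_add:
  assumes "exp_type_at_most \<sigma> f" "exp_type_at_most \<sigma> g"
  shows "exp_type_at_most \<sigma> (\<lambda>z. c * f z + g z)"
  unfolding exp_type_at_most_def
proof safe
  fix \<epsilon> :: real assume "\<epsilon> > 0"
  obtain C where C: "C > 0" "\<And>z. norm (f z) \<le> C * exp ((\<sigma> + \<epsilon>) * norm z)"
    using assms(1) \<open>\<epsilon> > 0\<close> unfolding exp_type_at_most_def by blast
  obtain D where D: "D > 0" "\<And>z. norm (g z) \<le> D * exp ((\<sigma> + \<epsilon>) * norm z)"
    using assms(2) \<open>\<epsilon> > 0\<close> unfolding exp_type_at_most_def by blast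
  have "norm (c * f z + g z) \<le> (norm c * C + D) * exp ((\<sigma> + \<epsilon>) * norm z)" for z
  proof -
    have "norm (c * f z + g z) \<le> norm c * norm (f z) + norm (g z)"
      by (metis norm_mult norm_triangle_ineq)
    also have "\<dots> \<le> norm c * (C * exp ((\<sigma> + \<epsilon>) * norm z)) + D * exp ((\<sigma> + \<epsilon>) * norm z)"
      by (intro add_mono mult_left_mono C D) auto
    finally show ?thesis by (simp add: algebra_simps)
  qed
  thus "\<exists>C>0. \<forall>z. norm (c * f z + g z) \<le> C * exp ((\<sigma> + \<epsilon>) * norm z)"
    using C(1) D(1) by (intro exI[of _ "norm c * C + D"]) (auto intro: add_nonneg_pos)
qed

text \<open>The estimates on bounded intervals are uniform in \<open>T\<close> and pass to the line.
  The radius \<open>r\<close> stays free, to be chosen depending on \<open>k\<close> later.\<close>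

lemma
  assumes "\<sigma> \<ge> 0" and hol: "f holomorphic_on UNIV" and type: "exp_type_at_most \<sigma> f"
    and L2: "square_integrable_real_line f"
  shows square_integrable_higher_deriv: "square_integrable_real_line ((deriv ^^ k) f)"
    and sq_integral_higher_deriv_le:
      "r > 0 \<Longrightarrow> sq_integral ((deriv ^^ k) f) \<le> (fact k * exp (\<sigma> * r) / r ^ k)\<^sup>2 * sq_integral f"
proof -
  have hol_k: "(deriv ^^ k) f holomorphic_on UNIV" using hol by (intro holomorphic_higher_deriv) auto
  have cont: "continuous_on UNIV (\<lambda>x::real. (norm ((deriv ^^ k) f (of_real x)))\<^sup>2)"
    by (intro continuous_intros continuous_on_of_real_entire hol_k)
  note * = integrable_lborel_of_bounded_Icc[OF cont _ integral_Icc_higher_deriv_le[OF assms]]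
  show "square_integrable_real_line ((deriv ^^ k) f)"
    using *(1)[of 1] continuous_on_of_real_entire[OF hol_k]
    by (auto simp: square_integrable_real_line_def borel_measurable_continuous_onI)
  show "sq_integral ((deriv ^^ k) f) \<le> (fact k * exp (\<sigma> * r) / r ^ k)\<^sup>2 * sq_integral f" if "r > 0"
    using *(2)[OF _ that] by (simp add: sq_integral_def)
qed

text \<open>A crude Stirling bound: with \<open>k = n + 1\<close> it reads
  \<open>fact k * exp k \<le> exp 1 * k ^ (k + 1)\<close>. The induction step needs
  \<open>exp 1 * (m / (m + 1)) ^ (m + 1) \<le> 1\<close>, which follows from
  \<open>1 + x \<le> exp x\<close> at \<open>x = - 1 / (m + 1)\<close>.\<close>

lemma fact_exp_le: "fact (Suc n) * exp (real (Suc n)) \<le> exp 1 * real (Suc n) ^ (n + 2)"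
proof (induction n)
  case (Suc n)
  define m where "m = real (Suc n)"
  have "m > 0" by (simp add: m_def)
  have "m / (m + 1) \<le> exp (- 1 / (m + 1))"
    using exp_ge_add_one_self[of "- 1 / (m + 1)"] \<open>m > 0\<close> by (simp add: field_simps)
  hence "(m / (m + 1)) ^ (n + 2) \<le> exp (- 1 / (m + 1)) ^ (n + 2)"
    using \<open>m > 0\<close> by (intro power_mono) auto
  also have "\<dots> = exp (- 1)"
  proof -
    have "real (n + 2) * (- 1 / (m + 1)) = - 1" by (simp add: m_def field_simps)
    thus ?thesis by (simp only: flip: exp_of_nat_mult)
  qed
  finally have "(m / (m + 1)) ^ (n + 2) * (m + 1) ^ (n + 2) \<le> exp (- 1) * (m + 1) ^ (n + 2)"
    using \<open>m > 0\<close> by (intro mult_right_mono) auto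
  hence "m ^ (n + 2) \<le> exp (- 1) * (m + 1) ^ (n + 2)"
    using \<open>m > 0\<close> unfolding power_mult_distrib[symmetric] by simp
  hence "exp 1 * m ^ (n + 2) \<le> exp 1 * (exp (- 1) * (m + 1) ^ (n + 2))"
    by (intro mult_left_mono) auto
  hence e: "exp 1 * m ^ (n + 2) \<le> (m + 1) ^ (n + 2)"
    by (simp only: mult.assoc[symmetric] exp_add[symmetric]) simp
  have "fact (Suc (Suc n)) * exp (real (Suc (Suc n))) = (m + 1) * exp 1 * (fact (Suc n) * exp m)"
  proof -
    have "exp (real (Suc (Suc n))) = exp 1 * exp m" by (simp add: m_def flip: exp_add)
    thus ?thesis by (simp only: fact_Suc[of "Suc n"]) (simp add: m_def)
  qed
  also have "\<dots> \<le> (m + 1) * exp 1 * (exp 1 * m ^ (n + 2))"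
    using Suc \<open>m > 0\<close> by (intro mult_left_mono) (auto simp: m_def)
  also have "\<dots> \<le> (m + 1) * exp 1 * (m + 1) ^ (n + 2)"
    using e \<open>m > 0\<close> by (intro mult_left_mono) auto
  finally show ?case by (simp add: m_def add_ac mult_ac)
qed simp

section \<open>Bernstein's inequality and positivity\<close>

text \<open>Integration by parts makes the sequence of norms \<open>a\<^sub>k\<close> of the derivatives log-convex, so
  \<open>a\<^sub>1 > \<sigma>\<^sup>2 a\<^sub>0\<close> would force geometric growth at a rate larger than \<open>\<sigma>\<^sup>2\<close>. The bound
  of \<open>sq_integral_higher_deriv_le\<close>, optimised at \<open>r = k / \<sigma>\<close>, allows only \<open>\<sigma>\<^bsup>2k\<^esup>\<close> up to a
  factor \<open>e\<^sup>2 k\<^sup>2\<close>.\<close>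

theorem L2_Bernstein:
  assumes "\<sigma> > 0" and hol: "f holomorphic_on UNIV" and type: "exp_type_at_most \<sigma> f"
    and L2: "square_integrable_real_line f"
  shows "sq_integral (deriv f) \<le> \<sigma>\<^sup>2 * sq_integral f"
proof (rule ccontr)
  define a where "a k = sq_integral ((deriv ^^ k) f)" for k
  have "\<sigma> \<ge> 0" using \<open>\<sigma> > 0\<close> by simp
  note L2_k = square_integrable_higher_deriv[OF \<open>\<sigma> \<ge> 0\<close> hol type L2]
  note a_le = sq_integral_higher_deriv_le[OF \<open>\<sigma> \<ge> 0\<close> hol type L2, folded a_def]
  have hol_k: "(deriv ^^ k) f holomorphic_on UNIV" for k
    using hol by (intro holomorphic_higher_deriv) auto
  assume "\<not> sq_integral (deriv f) \<le> \<sigma>\<^sup>2 * sq_integral f"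
  hence gt: "a 1 > \<sigma>\<^sup>2 * a 0" by (simp add: a_def)
  have a0: "a 0 > 0"
  proof (rule ccontr)
    assume "\<not> a 0 > 0"
    hence "a 0 = 0" using sq_integral_nonneg[of f] by (simp add: a_def)
    moreover from this have "a 1 \<le> 0" using a_le[of 1 1] by (simp add: a_def)
    ultimately show False using gt by simp
  qed
  define q where "q = a 1 / a 0"
  have q: "q > \<sigma>\<^sup>2" using gt a0 by (simp add: q_def field_simps)
  have "q > 0" using q \<open>\<sigma> > 0\<close> by (meson order.strict_trans zero_less_power)
  have quadratic: "c\<^sup>2 * a k - 2 * c * a (Suc k) + a (Suc (Suc k)) \<ge> 0" for c k
    using sq_integral_add_deriv2[OF hol_k L2_k, of k c] L2_k[of "Suc k"] L2_k[of "Suc (Suc k)"]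
      sq_integral_nonneg[of "\<lambda>z. of_real c * (deriv ^^ k) f z + deriv (deriv ((deriv ^^ k) f)) z"]
    by (simp add: a_def)
  \<comment> \<open>With \<open>c = q\<close> the quadratic form gives
    \<open>a (k + 2) \<ge> 2 * q * a (k + 1) - q\<^sup>2 * a k\<close>, and the induction hypothesis
    bounds the subtracted term by \<open>q * a (k + 1)\<close>. One fixed value of \<open>c\<close>
    thus serves all \<open>k\<close>.\<close>
  have step: "a (Suc k) \<ge> q * a k" for k
  proof (induction k)
    case (Suc k)
    have "q * (q * a k) \<le> q * a (Suc k)" using Suc \<open>q > 0\<close> by (intro mult_left_mono) auto
    thus ?case using quadratic[of q k] by (simp add: power2_eq_square mult.assoc)
  qed (use a0 in \<open>simp add: q_def\<close>)
  have geometric: "a k \<ge> q ^ k * a 0" for k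
  proof (induction k)
    case (Suc k)
    have "q * (q ^ k * a 0) \<le> q * a k" using Suc \<open>q > 0\<close> by (intro mult_left_mono) auto
    with step[of k] show ?case by (simp add: mult.assoc)
  qed simp
  define p where "p = \<sigma> / sqrt q"
  have "p > 0" using \<open>\<sigma> > 0\<close> \<open>q > 0\<close> by (simp add: p_def)
  have "p < 1" using q \<open>\<sigma> > 0\<close> \<open>q > 0\<close> by (simp add: p_def real_less_rsqrt)
  \<comment> \<open>Here \<open>p < 1\<close> is the ratio of the permitted growth rate to the
    forced one; the inequality fails in the limit because \<open>n * p ^ n\<close> tends to 0. Using
    \<open>Suc n\<close> keeps the radius \<open>k / \<sigma>\<close> positive.\<close>
  have "1 \<le> exp 1 * (real (Suc n) * p ^ Suc n)" for n
  proof -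
    define k where "k = Suc n"
    have "k > 0" by (simp add: k_def)
    define K where "K = fact k * exp (\<sigma> * (k / \<sigma>)) / (k / \<sigma>) ^ k"
    have "K \<ge> 0" using \<open>\<sigma> > 0\<close> by (simp add: K_def)
    have "q ^ k * a 0 \<le> K\<^sup>2 * a 0"
      using geometric[of k] a_le[of "k / \<sigma>" k] \<open>k > 0\<close> \<open>\<sigma> > 0\<close> unfolding K_def
      by (simp add: a_def[of 0])
    hence "(sqrt q ^ k)\<^sup>2 \<le> K\<^sup>2"
      using a0 \<open>q > 0\<close> by (simp flip: power_mult add: mult.commute[of k] power_mult)
    hence "sqrt q ^ k \<le> K" using \<open>K \<ge> 0\<close> by (rule power2_le_imp_le)
    also have "K = (fact k * exp k) / real k ^ k * \<sigma> ^ k"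
      using \<open>\<sigma> > 0\<close> by (simp add: K_def power_divide)
    also have "\<dots> \<le> (exp 1 * real k ^ (k + 1)) / real k ^ k * \<sigma> ^ k"
      using fact_exp_le[of n] \<open>\<sigma> > 0\<close>
      by (intro mult_right_mono divide_right_mono) (auto simp: k_def)
    also have "\<dots> = exp 1 * real k * \<sigma> ^ k" using \<open>k > 0\<close> by simp
    finally have "sqrt q ^ k \<le> exp 1 * real k * \<sigma> ^ k" .
    thus ?thesis using \<open>q > 0\<close> unfolding k_def[symmetric]
      by (simp add: p_def power_divide field_simps)
  qed
  moreover have "(\<lambda>n. exp 1 * (real (Suc n) * p ^ Suc n)) \<longlonglongrightarrow> exp 1 * 0"
    using powser_times_n_limit_0[of p] \<open>p > 0\<close> \<open>p < 1\<close>
    by (intro tendsto_mult_left LIMSEQ_Suc) simp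
  ultimately have "1 \<le> exp 1 * (0 :: real)"
    by (intro LIMSEQ_le_const[where X = "\<lambda>n. exp 1 * (real (Suc n) * p ^ Suc n)"]) auto
  thus False by simp
qed

text \<open>Pascal's rule splits the sum, and a shift of index collects it into first differences of
  \<open>b\<close>. Applied twice it produces the second differences that
  \<open>\<sigma>\<^sup>2 f + f''\<close> generates.\<close>

lemma alternating_choose_sum_Suc:
  fixes b :: "nat \<Rightarrow> 'a::comm_ring_1"
  shows "(\<Sum>k=0..Suc n. (-1) ^ k * of_nat (Suc n choose k) * b k) =
         (\<Sum>k=0..n. (-1) ^ k * of_nat (n choose k) * (b k - b (Suc k)))"
proof -
  have "(\<Sum>k=0..Suc n. (-1) ^ k * of_nat (Suc n choose k) * b k) =
      b 0 + (\<Sum>k=0..n. (-1) ^ Suc k * of_nat (n choose Suc k) * b (Suc k))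
          + (\<Sum>k=0..n. (-1) ^ Suc k * of_nat (n choose k) * b (Suc k))"
    by (subst sum.atLeast0_atMost_Suc_shift)
       (simp add: algebra_simps sum.distrib sum_negf sum_subtractf)
  also have "b 0 + (\<Sum>k=0..n. (-1) ^ Suc k * of_nat (n choose Suc k) * b (Suc k)) =
      (\<Sum>k=0..Suc n. (-1) ^ k * of_nat (n choose k) * b k)"
    by (subst sum.atLeast0_atMost_Suc_shift) simp
  also have "\<dots> = (\<Sum>k=0..n. (-1) ^ k * of_nat (n choose k) * b k)"
    by (simp add: binomial_eq_0)
  finally show ?thesis by (simp add: algebra_simps sum.distrib sum_negf sum_subtractf)
qed

lemma higher_deriv_cmult_add_deriv2:
  assumes hol: "f holomorphic_on UNIV"
  shows "(deriv ^^ k) (\<lambda>z. c * f z + deriv (deriv f) z) =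
           (\<lambda>z. c * (deriv ^^ k) f z + deriv (deriv ((deriv ^^ k) f)) z)"
proof
  fix z
  have hol2: "deriv (deriv f) holomorphic_on UNIV" using hol by (intro holomorphic_deriv) auto
  have "(\<lambda>z. c * f z) holomorphic_on UNIV" using hol by (intro holomorphic_intros)
  with hol hol2 have "(deriv ^^ k) (\<lambda>z. c * f z + deriv (deriv f) z) z =
      c * (deriv ^^ k) f z + (deriv ^^ k) (deriv (deriv f)) z"
    by (simp add: higher_deriv_add[of _ UNIV] higher_deriv_cmult[of _ UNIV])
  also have "(deriv ^^ k) (deriv (deriv f)) = deriv (deriv ((deriv ^^ k) f))"
    by (simp add: funpow_swap1)
  finally show "(deriv ^^ k) (\<lambda>z. c * f z + deriv (deriv f) z) z =
      c * (deriv ^^ k) f z + deriv (deriv ((deriv ^^ k) f)) z" .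
qed

text \<open>The sum is \<open>\<langle>(1 + D\<^sup>2 / \<sigma>\<^sup>2)\<^sup>N f, f\<rangle>\<close>. Passing from \<open>f\<close> to \<open>\<sigma>\<^sup>2 f + f''\<close> raises \<open>N\<close> by two,
  which leaves the cases \<open>N = 0\<close> and \<open>N = 1\<close>, the latter being Bernstein's inequality.\<close>

lemma alternating_sq_integral_sum_nonneg:
  assumes "\<sigma> > 0" "f holomorphic_on UNIV" "exp_type_at_most \<sigma> f" "square_integrable_real_line f"
  shows "(\<Sum>k=0..N. (-1) ^ k * real (N choose k) * (sq_integral ((deriv ^^ k) f) / \<sigma> ^ (2 * k))) \<ge> 0"
  using assms(2-)
proof (induction N arbitrary: f rule: induct_nat_012)
  case 0
  show ?case by (simp add: sq_integral_nonneg)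
next
  case 1
  from L2_Bernstein[OF \<open>\<sigma> > 0\<close> 1] show ?case
    using \<open>\<sigma> > 0\<close> by (simp add: field_simps power2_eq_square)
next
  case (ge2 N)
  define g where "g z = of_real (\<sigma>\<^sup>2) * f z + deriv (deriv f) z" for z
  define b where "b k = sq_integral ((deriv ^^ k) f) / \<sigma> ^ (2 * k)" for k
  have "\<sigma> \<ge> 0" using \<open>\<sigma> > 0\<close> by simp
  note L2_k = square_integrable_higher_deriv[OF \<open>\<sigma> \<ge> 0\<close> ge2.prems]
  have hol_k: "(deriv ^^ k) f holomorphic_on UNIV" for k
    using ge2.prems(1) by (intro holomorphic_higher_deriv) auto
  have "g holomorphic_on UNIV"
    unfolding g_def using ge2.prems(1) by (intro holomorphic_intros) auto
  moreover have "exp_type_at_most \<sigma> g"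
    unfolding g_def using ge2.prems \<open>\<sigma> \<ge> 0\<close>
    by (intro exp_type_at_most_cmult_add exp_type_at_most_deriv holomorphic_deriv) auto
  moreover have "square_integrable_real_line g"
    using square_integrable_add_deriv2[OF ge2.prems(1,3), of "\<sigma>\<^sup>2"] L2_k[of 1] L2_k[of 2]
    by (simp add: g_def[abs_def] numeral_2_eq_2)
  ultimately have "(\<Sum>k=0..N. (-1) ^ k * real (N choose k) *
      (sq_integral ((deriv ^^ k) g) / \<sigma> ^ (2 * k))) \<ge> 0"
    by (rule ge2.IH(1))
  \<comment> \<open>Taking \<open>c = \<sigma>\<^sup>2\<close> makes the three coefficients match
    the scaling in \<open>b\<close>, leaving \<open>\<sigma> ^ 4\<close> times a second
    difference.\<close>
  moreover have "sq_integral ((deriv ^^ k) g) / \<sigma> ^ (2 * k) =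
      \<sigma> ^ 4 * (b k - b (Suc k) - (b (Suc k) - b (Suc (Suc k))))" for k
  proof -
    have eq: "sq_integral ((deriv ^^ k) g) = (\<sigma>\<^sup>2)\<^sup>2 * sq_integral ((deriv ^^ k) f)
        - 2 * \<sigma>\<^sup>2 * sq_integral ((deriv ^^ Suc k) f) + sq_integral ((deriv ^^ Suc (Suc k)) f)"
      using sq_integral_add_deriv2[OF hol_k L2_k, of k "\<sigma>\<^sup>2"] L2_k[of "Suc k"] L2_k[of "Suc (Suc k)"]
      by (simp add: g_def[abs_def] higher_deriv_cmult_add_deriv2[OF ge2.prems(1)])
    thus ?thesis
      using \<open>\<sigma> > 0\<close> unfolding eq b_def
      by (simp add: field_simps power2_eq_square eval_nat_numeral)
  qed
  ultimately have "0 \<le> (\<Sum>k=0..N. (-1) ^ k * real (N choose k) *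
      (\<sigma> ^ 4 * (b k - b (Suc k) - (b (Suc k) - b (Suc (Suc k))))))"
    by (simp only:)
  also have "\<dots> = \<sigma> ^ 4 * (\<Sum>k=0..Suc (Suc N). (-1) ^ k * real (Suc (Suc N) choose k) * b k)"
    unfolding alternating_choose_sum_Suc sum_distrib_left by (simp only: mult_ac)
  finally show ?case
    using \<open>\<sigma> > 0\<close> by (simp add: zero_le_mult_iff b_def del: sum.atLeast0_atMost_Suc)
qed

text \<open>The conjunct on square integrability ensures that every \<open>sq_integral\<close> of a
  derivative is a genuine integral and not the default value 0.\<close>

theorem corollary5:
  fixes N :: nat and \<sigma> :: real and f :: "complex \<Rightarrow> complex"
  assumes "\<sigma> > 0"
    and "f holomorphic_on UNIV"
    and "exp_type_at_most \<sigma> f"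
    and "square_integrable_real_line f"
  shows "(\<forall>k. square_integrable_real_line ((deriv ^^ k) f)) \<and>
         (\<Sum>k=0..N. (-1) ^ k / \<sigma> ^ (2 * k) * real (N choose k) * sq_integral ((deriv ^^ k) f)) \<ge> 0 \<and>
         sq_integral (deriv f)
           \<le> 1 / 2 * (\<sigma>\<^sup>2 * sq_integral f + 1 / \<sigma>\<^sup>2 * sq_integral ((deriv ^^ 2) f))"
proof (intro conjI allI)
  show L2_k: "square_integrable_real_line ((deriv ^^ k) f)" for k
    using assms by (intro square_integrable_higher_deriv) auto
  show "(\<Sum>k=0..N. (-1) ^ k / \<sigma> ^ (2 * k) * real (N choose k) * sq_integral ((deriv ^^ k) f)) \<ge> 0"
    using alternating_sq_integral_sum_nonneg[OF assms, of N] by (simp add: mult_ac)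
  \<comment> \<open>The case of two derivatives is the nonnegativity of the norm of
    \<open>\<sigma>\<^sup>2 f + f''\<close>, expanded by parts and then divided by
    \<open>2 * \<sigma>\<^sup>2\<close>.\<close>
  have "0 \<le> (\<sigma>\<^sup>2)\<^sup>2 * sq_integral f - 2 * \<sigma>\<^sup>2 * sq_integral (deriv f) + sq_integral ((deriv ^^ 2) f)"
    using sq_integral_add_deriv2[OF assms(2,4), of "\<sigma>\<^sup>2"] L2_k[of 1] L2_k[of 2]
      sq_integral_nonneg[of "\<lambda>z. of_real (\<sigma>\<^sup>2) * f z + deriv (deriv f) z"]
    by (simp add: numeral_2_eq_2)
  thus "sq_integral (deriv f)
      \<le> 1 / 2 * (\<sigma>\<^sup>2 * sq_integral f + 1 / \<sigma>\<^sup>2 * sq_integral ((deriv ^^ 2) f))"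
    using \<open>\<sigma> > 0\<close> by (simp add: field_simps power2_eq_square)
qed

end
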